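(* Let a sequence of sparse vectors $\{\mathbf{x}^{(M)}\in\mathbb{C}^M\}_M$ with $\|\mathbf{x}^{(M)}\|_0=L=o(M)$ be given such that $L\mu^2(\mathbf{x}^{(M)})$ and $P$ are constant. Then asymptotic reliable recovery is possible for $\{\mathbf{x}^{(M)}\}$ with respect to Error Metric 2 if $N\succ C'_3\,L\log(M-L)$, for some constant $C'_3>0$ that depends only on $\alpha$, $\mu(\mathbf{x}^{(M)})$ and $\nu$.
   Context: Model: $\mathbf{x}=\mathbf{x}^{(M)}\in\mathbb{C}^M$ is an unknown vector with support $\mathcal{I}=\{i: x_i\ne0\}$, $\|\mathbf{x}\|_0=|\mathcal{I}|=L$, $\mu(\mathbf{x})=\min_{i\in\mathcal{I}}|x_i|$, and total power $P=\|\mathbf{x}\|_2^2$. One observes $\mathbf{y}=\mathbf{A}\mathbf{x}+\mathbf{n}\in\mathbb{C}^N$, where $N$ is a function of $M$, $\mathbf{A}$ is an $N\times M$ Gaussian measurement matrix (i.i.d. circularly symmetric complex Gaussian entries $a_{i,j}\sim\mathcal{N}_C(0,1)$), and $\mathbf{n}\sim\mathcal{N}_C(0,\nu^2I_N)$ is circularly symmetric complex Gaussian noise independent of $\mathbf{A}$. Decoder: a sparse recovery algorithm, knowing $\mathbf{A}$ and observing $\mathbf{y}$, outputs an estimate $\hat{\mathbf{x}}$ with $\|\hat{\mathbf{x}}\|_0=L$; a decoder $\mathcal{D}$ outputs the corresponding set of indices $\mathcal{D}(\mathbf{y})=\{i:\hat x_i\ne0\}$. Error Metric 2 (with parameter $\alpha\in(0,1)$):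 recovery is successful iff $\frac{|\{i:\hat x_i\ne0\}\cap\mathcal{I}|}{|\mathcal{I}|}>1-\alpha$; otherwise an error occurs. For fixed $\mathbf{A}$, $p_{\rm err}(\mathbf{A}|\mathbf{x}^{(M)})$ is the probability of error, and $p_{\rm err}(\mathcal{D}|\mathbf{x}^{(M)})=\mathbb{E}_{\mathbf{A}}\big(p_{\rm err}(\mathbf{A}|\mathbf{x}^{(M)})\big)$ is its average over Gaussian measurement matrices. A decoder achieves asymptotic reliable recovery if $p_{\rm err}(\mathcal{D}|\mathbf{x}^{(M)})\to0$ as $M\to\infty$; recovery is possible if some decoder achieves this. Notation: $f\succ g$ means that either $f=g=0$, or $f,g$ are non-decreasing non-negative functions and there is $x_0$ such that $f(x)/g(x)>1$ for all $x>x_0$ (here as functions of $M$). *)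

theory Defs
  imports "HOL-Probability.Probability" "HOL-Library.Landau_Symbols"
begin

text \<open>
  A vector of \<open>\<complex>\<^sup>M\<close> is a function \<open>nat \<Rightarrow> complex\<close> of which only the values on
  \<open>{..<M}\<close> matter; an \<open>N \<times> M\<close> matrix is a function on \<open>{..<N} \<times> {..<M}\<close>. The
  dimensions vary along the sequences considered, so they cannot be types.
\<close>

definition supp :: "nat \<Rightarrow> (nat \<Rightarrow> complex) \<Rightarrow> nat set" where
  "supp M x = {i. i < M \<and> x i \<noteq> 0}"

definition min_abs :: "nat \<Rightarrow> (nat \<Rightarrow> complex) \<Rightarrow> real" where
  "min_abs M x = Min ((\<lambda>i. cmod (x i)) ` supp M x)"

definition power :: "nat \<Rightarrow> (nat \<Rightarrow> complex) \<Rightarrow> real" where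
  "power M x = (\<Sum>i<M. (cmod (x i))\<^sup>2)"

text \<open>
  The circularly symmetric law with variance \<open>v > 0\<close>: real and imaginary parts are
  independent real Gaussians of variance \<open>v / 2\<close> each. (The second argument of
  \<^const>\<open>normal_density\<close> is the standard deviation.)
\<close>

definition complex_normal :: "real \<Rightarrow> complex measure" where
  "complex_normal v =
     distr (density lborel (normal_density 0 (sqrt (v / 2))) \<Otimes>\<^sub>M
            density lborel (normal_density 0 (sqrt (v / 2))))
           borel (\<lambda>(a, b). Complex a b)"

definition gaussian_matrix :: "nat \<Rightarrow> nat \<Rightarrow> (nat \<times> nat \<Rightarrow> complex) measure" where
  "gaussian_matrix N M = PiM ({..<N} \<times> {..<M}) (\<lambda>_. complex_normal 1)"

definition gaussian_noise :: "nat \<Rightarrow> real \<Rightarrow> (nat \<Rightarrow> complex) measure" where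
  "gaussian_noise N \<nu> = PiM {..<N} (\<lambda>_. complex_normal (\<nu>\<^sup>2))"

definition observation ::
  "nat \<Rightarrow> nat \<Rightarrow> (nat \<Rightarrow> complex) \<Rightarrow> (nat \<times> nat \<Rightarrow> complex) \<Rightarrow> (nat \<Rightarrow> complex) \<Rightarrow> nat \<Rightarrow> complex"
  where
  "observation N M x A n = (\<lambda>i\<in>{..<N}. (\<Sum>j<M. A (i, j) * x j) + n i)"

type_synonym decoder =
  "(nat \<times> nat \<Rightarrow> complex) \<Rightarrow> (nat \<Rightarrow> complex) \<Rightarrow> nat \<Rightarrow> complex"

text \<open>
  A decoder maps the known matrix and the observation to an estimate with exactly \<open>L\<close>
  nonzero entries; joint measurability makes the error probabilities below meaningful.
\<close>

definition is_decoder :: "nat \<Rightarrow> nat \<Rightarrow> nat \<Rightarrow> decoder \<Rightarrow> bool" where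
  "is_decoder N M L d \<longleftrightarrow>
     (\<lambda>(A, y). d A y) \<in>
        PiM ({..<N} \<times> {..<M}) (\<lambda>_. borel) \<Otimes>\<^sub>M PiM {..<N} (\<lambda>_. borel)
          \<rightarrow>\<^sub>M PiM {..<M} (\<lambda>_. borel) \<and>
     (\<forall>A \<in> ({..<N} \<times> {..<M}) \<rightarrow>\<^sub>E UNIV. \<forall>y \<in> {..<N} \<rightarrow>\<^sub>E UNIV. card (supp M (d A y)) = L)"

definition success2 :: "real \<Rightarrow> nat \<Rightarrow> (nat \<Rightarrow> complex) \<Rightarrow> (nat \<Rightarrow> complex) \<Rightarrow> bool" where
  "success2 \<alpha> M x xhat \<longleftrightarrow>
     real (card (supp M xhat \<inter> supp M x)) / real (card (supp M x)) > 1 - \<alpha>"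

definition p_err_given ::
  "real \<Rightarrow> real \<Rightarrow> nat \<Rightarrow> nat \<Rightarrow> decoder \<Rightarrow> (nat \<Rightarrow> complex) \<Rightarrow> (nat \<times> nat \<Rightarrow> complex) \<Rightarrow> real"
  where
  "p_err_given \<alpha> \<nu> N M d x A =
     measure (gaussian_noise N \<nu>)
       {n \<in> space (gaussian_noise N \<nu>). \<not> success2 \<alpha> M x (d A (observation N M x A n))}"

definition p_err ::
  "real \<Rightarrow> real \<Rightarrow> nat \<Rightarrow> nat \<Rightarrow> decoder \<Rightarrow> (nat \<Rightarrow> complex) \<Rightarrow> real" where
  "p_err \<alpha> \<nu> N M d x = (LINT A | gaussian_matrix N M. p_err_given \<alpha> \<nu> N M d x A)"

text \<open>
  Sequences are indexed by \<open>M \<ge> M\<^sub>0\<close>. The decoders (one per \<open>M\<close>) must serve every sequence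
  of the class \<open>X\<close>: a decoder chosen after the unknown vectors could just output their
  supports, and recovery would always be possible.
\<close>

definition recovery_possible2 ::
  "real \<Rightarrow> real \<Rightarrow> nat \<Rightarrow> (nat \<Rightarrow> nat) \<Rightarrow> (nat \<Rightarrow> nat) \<Rightarrow> (nat \<Rightarrow> nat \<Rightarrow> complex) set \<Rightarrow> bool"
  where
  "recovery_possible2 \<alpha> \<nu> M\<^sub>0 N L X \<longleftrightarrow>
     (\<exists>D. (\<forall>M\<ge>M\<^sub>0. is_decoder (N M) M (L M) (D M)) \<and>
          (\<forall>x\<in>X. (\<lambda>M. p_err \<alpha> \<nu> (N M) M (D M) (x M)) \<longlonglongrightarrow> 0))"

text \<open>
  The sequences with \<open>\<parallel>x\<^sup>M\<parallel>\<^sub>0 = L\<close>, with \<open>L \<mu>\<^sup>2(x\<^sup>M)\<close> constantly equal to \<open>\<kappa>\<close> and with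
  constant total power. The starting index matters: if \<open>M = 1\<close> were always included, then
  \<open>P = L \<mu>\<^sup>2\<close> there, and constancy would force all nonzero entries of every \<open>x\<^sup>M\<close> to have
  the same modulus.
\<close>

definition sparse_sequences ::
  "nat \<Rightarrow> (nat \<Rightarrow> nat) \<Rightarrow> real \<Rightarrow> (nat \<Rightarrow> nat \<Rightarrow> complex) set" where
  "sparse_sequences M\<^sub>0 L \<kappa> =
     {x. (\<forall>M\<ge>M\<^sub>0. card (supp M (x M)) = L M) \<and>
         (\<forall>M\<ge>M\<^sub>0. real (L M) * (min_abs M (x M))\<^sup>2 = \<kappa>) \<and>
         (\<exists>P. \<forall>M\<ge>M\<^sub>0. power M (x M) = P)}"

text \<open>The relation \<open>f \<succ> g\<close>, for functions defined on \<open>{M\<^sub>0..}\<close>.\<close>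

definition eventually_exceeds :: "nat \<Rightarrow> (nat \<Rightarrow> real) \<Rightarrow> (nat \<Rightarrow> real) \<Rightarrow> bool" where
  "eventually_exceeds M\<^sub>0 f g \<longleftrightarrow>
     (\<forall>M\<ge>M\<^sub>0. f M = 0 \<and> g M = 0) \<or>
     (mono_on {M\<^sub>0..} f \<and> mono_on {M\<^sub>0..} g \<and>
      (\<forall>M\<ge>M\<^sub>0. 0 \<le> f M \<and> 0 \<le> g M) \<and>
      (\<exists>x\<^sub>0. \<forall>M\<ge>M\<^sub>0. M > x\<^sub>0 \<longrightarrow> f M / g M > 1))"

end

theory Submission
  imports Defs
begin

text \<open>
  Quantise the unknown vector: the candidates are the \<open>L\<close>-sparse vectors whose nonzero entries
  lie on a grid of mesh \<open>1 / M\<close>, and there are at most \<open>M ^ (9 * L)\<close> of them. The decoder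
  returns a candidate \<open>z\<close> with \<open>\<parallel>y - A z\<parallel>\<^sup>2 \<le> N \<theta>\<close>, where \<open>\<theta> = \<nu>\<^sup>2 + \<alpha> \<kappa> / 2\<close>.
  For a fixed \<open>z\<close> the entries of \<open>y - A z\<close> are independent complex Gaussians of variance
  \<open>s = \<parallel>x - z\<parallel>\<^sup>2 + \<nu>\<^sup>2\<close>. The candidate nearest to \<open>x\<close> has \<open>s\<close> close to \<open>\<nu>\<^sup>2\<close>, whereas a
  candidate missing an \<open>\<alpha>\<close>-fraction of the support has \<open>s \<ge> \<nu>\<^sup>2 + \<alpha> \<kappa>\<close>. So in both cases
  the Chernoff bound, based on \<open>E exp (- t \<parallel>y - A z\<parallel>\<^sup>2) = (1 + t s) ^ (-N)\<close>, shows that the residual is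
  on the wrong side of \<open>N \<theta>\<close> with probability at most \<open>exp (- c N)\<close>. The union bound over the
  candidates closes the argument once \<open>c N \<ge> 10 L ln M\<close>. Nothing here needs to know \<open>P\<close>, since
  the range of the grid grows with \<open>M\<close>.
\<close>


section \<open>Gaussian integrals of exponentials of squares\<close>

text \<open>Completing the square turns the density times the exponential into \<open>K\<close>
  times the normal density with mean \<open>m\<close> and deviation \<open>\<tau>\<close>. Negative
  \<open>s\<close> are covered as well, because the upper tail of the residual needs them.\<close>

lemma nn_integral_normal_exp_square:
  fixes s \<sigma> \<beta> :: real
  assumes "\<sigma> > 0" and pos: "1 + 2 * s * \<sigma>\<^sup>2 > 0"
  shows "(\<integral>\<^sup>+g. ennreal (exp (- s * (g + \<beta>)\<^sup>2)) \<partial>density lborel (normal_density 0 \<sigma>)) =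
    ennreal (exp (- s * \<beta>\<^sup>2 / (1 + 2 * s * \<sigma>\<^sup>2)) / sqrt (1 + 2 * s * \<sigma>\<^sup>2))"
proof -
  define q where "q = 1 + 2 * s * \<sigma>\<^sup>2"
  define \<tau> where "\<tau> = \<sigma> / sqrt q"
  define m where "m = - 2 * s * \<beta> * \<sigma>\<^sup>2 / q"
  define K where "K = exp (- s * \<beta>\<^sup>2 / q) / sqrt q"
  have q: "q > 0" using pos by (simp add: q_def)
  have \<tau>: "\<tau> > 0" using q assms by (simp add: \<tau>_def)
  have \<tau>2: "\<tau>\<^sup>2 = \<sigma>\<^sup>2 / q" using q by (simp add: \<tau>_def power_divide)
  have K: "K \<ge> 0" using q by (simp add: K_def)
  have eq: "normal_density 0 \<sigma> g * exp (- s * (g + \<beta>)\<^sup>2) = K * normal_density m \<tau> g" for g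
  proof -
    have s: "s = (q - 1) / (2 * \<sigma>\<^sup>2)"
      using assms by (simp add: q_def field_simps)
    have e: "- (g\<^sup>2 / (2 * \<sigma>\<^sup>2)) - s * (g + \<beta>)\<^sup>2 = - s * \<beta>\<^sup>2 / q - (g - m)\<^sup>2 / (2 * \<tau>\<^sup>2)"
      using q assms unfolding \<tau>2 m_def s
      by (simp add: field_simps power2_eq_square)
    have "sqrt (2 * pi * \<sigma>\<^sup>2) = sqrt q * sqrt (2 * pi * \<tau>\<^sup>2)"
      using q by (simp add: \<tau>2 real_sqrt_mult[symmetric])
    then show ?thesis
      using arg_cong[OF e, of exp]
      unfolding normal_density_def K_def
      by (simp add: exp_diff exp_minus field_simps)
  qed
  have "(\<integral>\<^sup>+g. ennreal (exp (- s * (g + \<beta>)\<^sup>2)) \<partial>density lborel (normal_density 0 \<sigma>)) =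
    (\<integral>\<^sup>+g. ennreal (normal_density 0 \<sigma> g) * ennreal (exp (- s * (g + \<beta>)\<^sup>2)) \<partial>lborel)"
    by (subst nn_integral_density) auto
  also have "\<dots> = (\<integral>\<^sup>+g. ennreal K * ennreal (normal_density m \<tau> g) \<partial>lborel)"
    using eq K by (simp add: ennreal_mult'[symmetric])
  also have "\<dots> = ennreal K * (\<integral>\<^sup>+g. ennreal (normal_density m \<tau> g) \<partial>lborel)"
    by (rule nn_integral_cmult) auto
  also have "(\<integral>\<^sup>+g. ennreal (normal_density m \<tau> g) \<partial>lborel) = 1"
    using \<tau> by (subst nn_integral_eq_integral) auto
  finally show ?thesis by (simp add: K_def q_def)
qed

lemma Complex_measurable [measurable]:
  "(\<lambda>(a, b). Complex a b) \<in> borel_measurable (borel \<Otimes>\<^sub>M borel)"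
  unfolding Complex_eq by measurable

lemma sets_complex_normal [simp, measurable_cong]: "sets (complex_normal v) = sets borel"
  by (simp add: complex_normal_def)

lemma space_complex_normal [simp]: "space (complex_normal v) = UNIV"
  by (simp add: complex_normal_def)

lemma prob_space_complex_normal:
  assumes "v > 0" shows "prob_space (complex_normal v)"
proof -
  let ?D = "density lborel (normal_density 0 (sqrt (v / 2)))"
  interpret D: prob_space ?D
    using assms by (intro prob_space_normal_density) simp
  interpret pair_prob_space ?D ?D ..
  show ?thesis
    unfolding complex_normal_def by (rule prob_space_distr) measurable
qed

lemma nn_integral_complex_normal:
  assumes [measurable]: "f \<in> borel_measurable borel" and "v > 0"
  shows "(\<integral>\<^sup>+w. f w \<partial>complex_normal v) =
    (\<integral>\<^sup>+a. \<integral>\<^sup>+b. f (Complex a b) \<partial>density lborel (normal_density 0 (sqrt (v / 2)))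
      \<partial>density lborel (normal_density 0 (sqrt (v / 2))))"
proof -
  let ?D = "density lborel (normal_density 0 (sqrt (v / 2)))"
  interpret D: prob_space ?D
    using assms by (intro prob_space_normal_density) simp
  have "(\<integral>\<^sup>+w. f w \<partial>complex_normal v) = (\<integral>\<^sup>+p. f (case p of (a, b) \<Rightarrow> Complex a b) \<partial>(?D \<Otimes>\<^sub>M ?D))"
    unfolding complex_normal_def by (rule nn_integral_distr) measurable
  also have "\<dots> = (\<integral>\<^sup>+a. \<integral>\<^sup>+b. f (Complex a b) \<partial>?D \<partial>?D)"
    by (subst D.nn_integral_fst[symmetric]) auto
  finally show ?thesis .
qed

text \<open>For \<open>c \<noteq> 0\<close> write \<open>c * w + b = c * (w + b / c)\<close>. The
  squared modulus then splits into real and imaginary parts, which are independent of variance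
  \<open>v / 2\<close>. Each of them contributes a factor \<open>1 / sqrt q\<close>, so the square
  roots disappear.\<close>

lemma nn_integral_complex_normal_exp_square:
  fixes c b :: complex and t v :: real
  assumes "v > 0" and pos: "1 + t * v * (cmod c)\<^sup>2 > 0"
  shows "(\<integral>\<^sup>+w. ennreal (exp (- t * (cmod (c * w + b))\<^sup>2)) \<partial>complex_normal v) =
    ennreal (exp (- t * (cmod b)\<^sup>2 / (1 + t * v * (cmod c)\<^sup>2)) / (1 + t * v * (cmod c)\<^sup>2))"
proof (cases "c = 0")
  case True
  interpret prob_space "complex_normal v" by (rule prob_space_complex_normal) fact
  show ?thesis using True emeasure_space_1 by simp
next
  case False
  let ?D = "density lborel (normal_density 0 (sqrt (v / 2)))"
  define s where "s = t * (cmod c)\<^sup>2"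
  define \<beta> where "\<beta> = b / c"
  define q where "q = 1 + s * v"
  have q: "q > 0" using pos by (simp add: q_def s_def mult_ac)
  have q': "1 + 2 * s * (sqrt (v / 2))\<^sup>2 = q" using assms by (simp add: q_def)
  have e: "- t * (cmod (c * Complex x y + b))\<^sup>2 = - s * (x + Re \<beta>)\<^sup>2 + - s * (y + Im \<beta>)\<^sup>2" for x y
  proof -
    have "c * Complex x y + b = c * (Complex x y + \<beta>)"
      using False by (simp add: \<beta>_def field_simps)
    then have "(cmod (c * Complex x y + b))\<^sup>2 = (cmod c)\<^sup>2 * (cmod (Complex x y + \<beta>))\<^sup>2"
      by (simp add: norm_mult power_mult_distrib)
    then show ?thesis by (simp add: cmod_power2 s_def algebra_simps)
  qed
  have G: "(\<integral>\<^sup>+g. ennreal (exp (- s * (g + \<gamma>)\<^sup>2)) \<partial>?D) = ennreal (exp (- s * \<gamma>\<^sup>2 / q) / sqrt q)" for \<gamma>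
    using nn_integral_normal_exp_square[of "sqrt (v / 2)" s \<gamma>] q assms unfolding q' by simp
  have "(\<integral>\<^sup>+w. ennreal (exp (- t * (cmod (c * w + b))\<^sup>2)) \<partial>complex_normal v) =
    (\<integral>\<^sup>+x. \<integral>\<^sup>+y. ennreal (exp (- t * (cmod (c * Complex x y + b))\<^sup>2)) \<partial>?D \<partial>?D)"
    using assms by (subst nn_integral_complex_normal) auto
  also have "\<dots> = (\<integral>\<^sup>+x. \<integral>\<^sup>+y. ennreal (exp (- s * (x + Re \<beta>)\<^sup>2)) * ennreal (exp (- s * (y + Im \<beta>)\<^sup>2)) \<partial>?D \<partial>?D)"
    unfolding e exp_add by (simp only: ennreal_mult' exp_ge_zero)
  also have "\<dots> = (\<integral>\<^sup>+x. ennreal (exp (- s * (x + Re \<beta>)\<^sup>2)) \<partial>?D) * (\<integral>\<^sup>+y. ennreal (exp (- s * (y + Im \<beta>)\<^sup>2)) \<partial>?D)"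
    by (subst nn_integral_cmult, simp) (subst nn_integral_multc, auto)
  also have "\<dots> = ennreal (exp (- s * (Re \<beta>)\<^sup>2 / q) / sqrt q * (exp (- s * (Im \<beta>)\<^sup>2 / q) / sqrt q))"
    unfolding G using q by (simp add: ennreal_mult'[symmetric])
  also have "exp (- s * (Re \<beta>)\<^sup>2 / q) / sqrt q * (exp (- s * (Im \<beta>)\<^sup>2 / q) / sqrt q) = exp (- s * (cmod \<beta>)\<^sup>2 / q) / q"
    using q by (simp add: exp_add[symmetric] cmod_power2 field_simps)
  also have "s * (cmod \<beta>)\<^sup>2 = t * (cmod b)\<^sup>2"
    using False by (simp add: \<beta>_def s_def norm_divide power_divide)
  then have "- s * (cmod \<beta>)\<^sup>2 = - t * (cmod b)\<^sup>2" by simp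
  also have "q = 1 + t * v * (cmod c)\<^sup>2" by (simp add: q_def s_def mult_ac)
  finally show ?thesis .
qed


section \<open>Laplace transform for several linear forms in disjoint sets of Gaussians\<close>

text \<open>
  Functions of the form \<open>exp (- t \<bar>c w + b\<bar>\<^sup>2)\<close> stay of this form, with \<open>t\<close> replaced by
  \<open>t / (1 + t v \<bar>c\<bar>\<^sup>2)\<close>, when one Gaussian is integrated out. Iterating this yields the Laplace
  transform of the squared modulus of a linear form without determining the law of that form. The
  map \<open>r\<close> assigns to each Gaussian the only form in which it occurs.
\<close>

lemma nn_integral_PiM_complex_normal_exp_squares:
  fixes c :: "'k \<Rightarrow> complex" and r :: "'k \<Rightarrow> 'i" and t :: "'i \<Rightarrow> real" and v :: real
  assumes "finite K" and "finite I" and "r ` K \<subseteq> I" and v: "v > 0"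
    and "\<And>i. i \<in> I \<Longrightarrow> 1 + t i * v * (\<Sum>k\<in>{k\<in>K. r k = i}. (cmod (c k))\<^sup>2) > 0"
  shows "(\<integral>\<^sup>+X. (\<Prod>i\<in>I. ennreal (exp (- t i * (cmod ((\<Sum>k\<in>{k\<in>K. r k = i}. c k * X k) + b i))\<^sup>2)))
      \<partial>PiM K (\<lambda>_. complex_normal v)) =
    (\<Prod>i\<in>I. ennreal (exp (- t i * (cmod (b i))\<^sup>2 / (1 + t i * v * (\<Sum>k\<in>{k\<in>K. r k = i}. (cmod (c k))\<^sup>2)))
      / (1 + t i * v * (\<Sum>k\<in>{k\<in>K. r k = i}. (cmod (c k))\<^sup>2))))"
  using assms(1,3,5)
\<comment> \<open>The parameters \<open>t\<close> must be general: the induction hypothesis is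
  applied to \<open>t'\<close>, which differs from \<open>t\<close> at the form containing the new
  Gaussian.\<close>
proof (induction K arbitrary: t rule: finite_induct)
  case empty
  then show ?case by (simp add: PiM_empty nn_integral_count_space_finite)
next
  case (insert k K)
  interpret P: prob_space "complex_normal v" by (rule prob_space_complex_normal) fact
  interpret PP: product_sigma_finite "\<lambda>_. complex_normal v" ..
  let ?row = "\<lambda>K i. {k\<in>K. r k = i}"
  define S where "S i = (\<Sum>k\<in>?row K i. (cmod (c k))\<^sup>2)" for i
  define lin where "lin X i = (\<Sum>k\<in>?row K i. c k * X k) + b i" for X i
  define i0 where "i0 = r k"
  define a where "a = (cmod (c k))\<^sup>2"
  define q where "q = 1 + t i0 * v * a"
  define t' where "t' = t(i0 := t i0 / q)"
  have i0: "i0 \<in> I" using insert.prems by (auto simp: i0_def)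
  have row: "?row (insert k K) i = (if i = i0 then insert k (?row K i) else ?row K i)" for i
    by (auto simp: i0_def)
  have kn: "k \<notin> ?row K i" and fin: "finite (?row K i)" for i using insert.hyps by auto
  have S': "(\<Sum>k\<in>?row (insert k K) i. (cmod (c k))\<^sup>2) = (if i = i0 then a + S i else S i)" for i
    unfolding row S_def a_def by (cases "i = i0") (simp_all only: if_True if_False sum.insert[OF fin kn] refl)
  have pos: "1 + t i * v * (if i = i0 then a + S i else S i) > 0" if "i \<in> I" for i
    using insert.prems(2)[OF that] unfolding S' .
  have S0: "S i \<ge> 0" for i unfolding S_def by (intro sum_nonneg) auto
  have a0: "a \<ge> 0" by (simp add: a_def)
  \<comment> \<open>Positivity is given only for the whole sum \<open>a + S i0\<close>. If
    \<open>t i0\<close> is negative, dropping \<open>S i0\<close> can only increase the expression;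
    otherwise \<open>q\<close> is at least 1.\<close>
  have q: "q > 0"
  proof (cases "t i0 \<ge> 0")
    case True
    then have "t i0 * v * a \<ge> 0" using v a0 by simp
    then show ?thesis by (simp add: q_def)
  next
    case False
    then have "t i0 * v * S i0 \<le> 0" using v S0[of i0] by (simp add: mult_nonpos_nonneg)
    then show ?thesis using pos[OF i0] by (simp add: q_def algebra_simps)
  qed
  \<comment> \<open>The factors produced by successive integrations multiply to the factor for the
    whole sum; this is what closes the induction.\<close>
  have q': "q * (1 + t' i0 * v * S i0) = 1 + t i0 * v * (a + S i0)"
    using q by (simp add: t'_def field_simps) (simp add: q_def algebra_simps)
  have pos0: "1 + t' i0 * v * S i0 > 0"
    using q' pos[OF i0] q by (metis zero_less_mult_pos)
  have pos': "1 + t' i * v * S i > 0" if "i \<in> I" for i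
    using pos0 pos[OF that] by (cases "i = i0") (auto simp: t'_def)
  have upd: "(\<Sum>j\<in>?row (insert k K) i. c j * (X(k := y)) j) + b i
      = (if i = i0 then c k * y + lin X i else lin X i)" for X y i
  proof -
    have "(\<Sum>j\<in>?row K i. c j * (X(k := y)) j) = (\<Sum>j\<in>?row K i. c j * X j)"
      using kn[of i] by (intro sum.cong) auto
    then show ?thesis
      unfolding row lin_def by (cases "i = i0") (simp_all only: if_True if_False sum.insert[OF fin kn] add.assoc fun_upd_same refl)
  qed
  \<comment> \<open>The new variable occurs only in the form \<open>i0\<close>, so all other factors
    leave the inner integral as constants.\<close>
  have inner: "(\<integral>\<^sup>+y. (\<Prod>i\<in>I. ennreal (exp (- t i * (cmod ((\<Sum>j\<in>?row (insert k K) i. c j * (X(k := y)) j) + b i))\<^sup>2)))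
      \<partial>complex_normal v)
    = ennreal (1 / q) * (\<Prod>i\<in>I. ennreal (exp (- t' i * (cmod (lin X i))\<^sup>2)))" for X
  proof -
    let ?R = "\<Prod>i\<in>I - {i0}. ennreal (exp (- t i * (cmod (lin X i))\<^sup>2))"
    have "(\<integral>\<^sup>+y. (\<Prod>i\<in>I. ennreal (exp (- t i * (cmod ((\<Sum>j\<in>?row (insert k K) i. c j * (X(k := y)) j) + b i))\<^sup>2)))
        \<partial>complex_normal v)
      = (\<integral>\<^sup>+y. ennreal (exp (- t i0 * (cmod (c k * y + lin X i0))\<^sup>2)) * ?R \<partial>complex_normal v)"
      unfolding upd using i0 \<open>finite I\<close> by (subst prod.remove[of I i0]) auto
    also have "\<dots> = (\<integral>\<^sup>+y. ennreal (exp (- t i0 * (cmod (c k * y + lin X i0))\<^sup>2)) \<partial>complex_normal v) * ?R"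
      by (rule nn_integral_multc) auto
    also have "\<dots> = ennreal (exp (- t i0 * (cmod (lin X i0))\<^sup>2 / q) / q) * ?R"
      using q v by (subst nn_integral_complex_normal_exp_square) (auto simp: q_def a_def)
    also have "ennreal (exp (- t i0 * (cmod (lin X i0))\<^sup>2 / q) / q) =
        ennreal (1 / q) * ennreal (exp (- t' i0 * (cmod (lin X i0))\<^sup>2))"
      using q by (simp add: ennreal_mult'[symmetric] t'_def)
    also have "?R = (\<Prod>i\<in>I - {i0}. ennreal (exp (- t' i * (cmod (lin X i))\<^sup>2)))"
      by (intro prod.cong) (auto simp: t'_def)
    finally show ?thesis
      using i0 \<open>finite I\<close> by (subst prod.remove[of I i0]) (auto simp: mult.assoc)
  qed
  have "(\<integral>\<^sup>+X. (\<Prod>i\<in>I. ennreal (exp (- t i * (cmod ((\<Sum>j\<in>?row (insert k K) i. c j * X j) + b i))\<^sup>2)))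
      \<partial>PiM (insert k K) (\<lambda>_. complex_normal v)) =
    (\<integral>\<^sup>+X. ennreal (1 / q) * (\<Prod>i\<in>I. ennreal (exp (- t' i * (cmod (lin X i))\<^sup>2))) \<partial>PiM K (\<lambda>_. complex_normal v))"
    unfolding inner[symmetric]
    by (rule PP.product_nn_integral_insert) (use insert.hyps in auto)
  also have "\<dots> = ennreal (1 / q) * (\<integral>\<^sup>+X. (\<Prod>i\<in>I. ennreal (exp (- t' i * (cmod (lin X i))\<^sup>2))) \<partial>PiM K (\<lambda>_. complex_normal v))"
    unfolding lin_def by (rule nn_integral_cmult) measurable
  also have "(\<integral>\<^sup>+X. (\<Prod>i\<in>I. ennreal (exp (- t' i * (cmod (lin X i))\<^sup>2))) \<partial>PiM K (\<lambda>_. complex_normal v))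
    = (\<Prod>i\<in>I. ennreal (exp (- t' i * (cmod (b i))\<^sup>2 / (1 + t' i * v * S i)) / (1 + t' i * v * S i)))"
    unfolding lin_def S_def
    by (rule insert.IH) (use insert.prems pos' in \<open>auto simp: S_def\<close>)
  also have "ennreal (1 / q) * \<dots> = (ennreal (1 / q) *
        ennreal (exp (- t' i0 * (cmod (b i0))\<^sup>2 / (1 + t' i0 * v * S i0)) / (1 + t' i0 * v * S i0))) *
      (\<Prod>i\<in>I - {i0}. ennreal (exp (- t' i * (cmod (b i))\<^sup>2 / (1 + t' i * v * S i)) / (1 + t' i * v * S i)))"
    using i0 \<open>finite I\<close> by (subst prod.remove[of I i0]) (auto simp: mult.assoc)
  also have "ennreal (1 / q) *
        ennreal (exp (- t' i0 * (cmod (b i0))\<^sup>2 / (1 + t' i0 * v * S i0)) / (1 + t' i0 * v * S i0)) =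
      ennreal (exp (- t i0 * (cmod (b i0))\<^sup>2 / (1 + t i0 * v * (a + S i0))) / (1 + t i0 * v * (a + S i0)))"
  proof -
    have "- t' i0 * (cmod (b i0))\<^sup>2 / (1 + t' i0 * v * S i0) = - t i0 * (cmod (b i0))\<^sup>2 / (1 + t i0 * v * (a + S i0))"
      unfolding q'[symmetric] by (simp add: t'_def)
    then show ?thesis
      using q pos0 unfolding q'[symmetric] by (simp add: ennreal_mult'[symmetric])
  qed
  also have "(\<Prod>i\<in>I - {i0}. ennreal (exp (- t' i * (cmod (b i))\<^sup>2 / (1 + t' i * v * S i)) / (1 + t' i * v * S i)))
    = (\<Prod>i\<in>I - {i0}. ennreal (exp (- t i * (cmod (b i))\<^sup>2 / (1 + t i * v * S i)) / (1 + t i * v * S i)))"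
    by (intro prod.cong) (auto simp: t'_def)
  finally show ?case
    unfolding S' using i0 \<open>finite I\<close> by (subst prod.remove[of I i0]) auto
qed

section \<open>Laplace transform of the residual\<close>

definition residual :: "nat \<Rightarrow> nat \<Rightarrow> (nat \<times> nat \<Rightarrow> complex) \<Rightarrow> (nat \<Rightarrow> complex) \<Rightarrow> (nat \<Rightarrow> complex) \<Rightarrow> real"
  where "residual N M A y z = (\<Sum>i<N. (cmod (y i - (\<Sum>j<M. A (i, j) * z j)))\<^sup>2)"

lemma residual_observation:
  "residual N M A (observation N M x A n) z =
    (\<Sum>i<N. (cmod (n i + (\<Sum>j<M. A (i, j) * (x j - z j))))\<^sup>2)"
  unfolding residual_def observation_def
  by (intro sum.cong) (simp_all add: algebra_simps sum_subtractf)

text \<open>This is the general formula with \<open>r = id\<close>: each form contains a single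
  noise variable. The remaining product has the same shape in \<open>w\<close>, which will be the
  image under the matrix of the difference between the unknown vector and a candidate. The integrand
  compares the residual with \<open>N * \<theta>\<close> in the form required by the Chernoff
  bound.\<close>

lemma nn_integral_noise_exp_squares:
  fixes w :: "nat \<Rightarrow> complex"
  assumes "\<nu> > 0" and pos: "1 + t * \<nu>\<^sup>2 > 0"
  shows "(\<integral>\<^sup>+n. ennreal (exp (t * (real N * \<theta> - (\<Sum>i<N. (cmod (n i + w i))\<^sup>2)))) \<partial>gaussian_noise N \<nu>) =
    ennreal ((exp (t * \<theta>) / (1 + t * \<nu>\<^sup>2)) ^ N) * (\<Prod>i<N. ennreal (exp (- (t / (1 + t * \<nu>\<^sup>2)) * (cmod (w i))\<^sup>2)))"
proof -
  have row: "{k \<in> {..<N}. id k = i} = {i}" if "i \<in> {..<N}" for i using that by auto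
  have "ennreal (exp (t * (real N * \<theta> - (\<Sum>i<N. (cmod (n i + w i))\<^sup>2)))) = ennreal (exp (t * \<theta>) ^ N) *
      (\<Prod>i<N. ennreal (exp (- t * (cmod ((\<Sum>k\<in>{k \<in> {..<N}. id k = i}. 1 * n k) + w i))\<^sup>2)))" for n
  proof -
    have "(\<Prod>i<N. ennreal (exp (- t * (cmod ((\<Sum>k\<in>{k \<in> {..<N}. id k = i}. 1 * n k) + w i))\<^sup>2)))
        = (\<Prod>i<N. ennreal (exp (- t * (cmod (n i + w i))\<^sup>2)))"
      by (intro prod.cong refl) (simp only: row, simp)
    also have "\<dots> = ennreal (exp (- t * (\<Sum>i<N. (cmod (n i + w i))\<^sup>2)))"
      by (simp add: prod_ennreal exp_sum[symmetric] sum_negf sum_distrib_left)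
    finally show ?thesis
      by (simp add: ennreal_mult'[symmetric] exp_of_nat_mult[symmetric] exp_add[symmetric] algebra_simps)
  qed
  then have "(\<integral>\<^sup>+n. ennreal (exp (t * (real N * \<theta> - (\<Sum>i<N. (cmod (n i + w i))\<^sup>2)))) \<partial>gaussian_noise N \<nu>) =
    (\<integral>\<^sup>+n. ennreal (exp (t * \<theta>) ^ N) *
      (\<Prod>i<N. ennreal (exp (- t * (cmod ((\<Sum>k\<in>{k \<in> {..<N}. id k = i}. 1 * n k) + w i))\<^sup>2))) \<partial>gaussian_noise N \<nu>)"
    by (simp only:)
  also have "\<dots> = ennreal (exp (t * \<theta>) ^ N) *
    (\<integral>\<^sup>+n. (\<Prod>i<N. ennreal (exp (- t * (cmod ((\<Sum>k\<in>{k \<in> {..<N}. id k = i}. 1 * n k) + w i))\<^sup>2))) \<partial>gaussian_noise N \<nu>)"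
    unfolding gaussian_noise_def by (rule nn_integral_cmult) measurable
  also have "(\<integral>\<^sup>+n. (\<Prod>i<N. ennreal (exp (- t * (cmod ((\<Sum>k\<in>{k \<in> {..<N}. id k = i}. 1 * n k) + w i))\<^sup>2))) \<partial>gaussian_noise N \<nu>)
     = (\<Prod>i<N. ennreal (exp (- t * (cmod (w i))\<^sup>2 / (1 + t * \<nu>\<^sup>2 * (\<Sum>k\<in>{k \<in> {..<N}. id k = i}. (cmod 1)\<^sup>2)))
         / (1 + t * \<nu>\<^sup>2 * (\<Sum>k\<in>{k \<in> {..<N}. id k = i}. (cmod 1)\<^sup>2))))"
    unfolding gaussian_noise_def
    by (rule nn_integral_PiM_complex_normal_exp_squares) (use assms in \<open>auto simp only: row, auto\<close>)
  also have "\<dots> = (\<Prod>i<N. ennreal (1 / (1 + t * \<nu>\<^sup>2)) * ennreal (exp (- (t / (1 + t * \<nu>\<^sup>2)) * (cmod (w i))\<^sup>2)))"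
    using pos by (intro prod.cong) (simp_all only: row, simp_all add: ennreal_mult'[symmetric])
  also have "\<dots> = ennreal ((1 / (1 + t * \<nu>\<^sup>2)) ^ N) * (\<Prod>i<N. ennreal (exp (- (t / (1 + t * \<nu>\<^sup>2)) * (cmod (w i))\<^sup>2)))"
    using pos by (simp add: prod.distrib ennreal_power)
  also have "ennreal (exp (t * \<theta>) ^ N) * \<dots> = ennreal ((exp (t * \<theta>) / (1 + t * \<nu>\<^sup>2)) ^ N) *
      (\<Prod>i<N. ennreal (exp (- (t / (1 + t * \<nu>\<^sup>2)) * (cmod (w i))\<^sup>2)))"
    using pos by (simp add: mult.assoc[symmetric] ennreal_mult'[symmetric] power_divide)
  finally show ?thesis .
qed

text \<open>This is the general formula with \<open>r = fst\<close>: each form uses one row of the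
  matrix. The forms have no constant term, so no exponential survives.\<close>

lemma nn_integral_matrix_exp_squares:
  fixes d :: "nat \<Rightarrow> complex"
  assumes pos: "1 + t * (\<Sum>j<M. (cmod (d j))\<^sup>2) > 0"
  shows "(\<integral>\<^sup>+A. (\<Prod>i<N. ennreal (exp (- t * (cmod (\<Sum>j<M. A (i, j) * d j))\<^sup>2))) \<partial>gaussian_matrix N M) =
    ennreal ((1 / (1 + t * (\<Sum>j<M. (cmod (d j))\<^sup>2))) ^ N)"
proof -
  have row: "{k \<in> {..<N} \<times> {..<M}. fst k = i} = Pair i ` {..<M}" if "i \<in> {..<N}" for i using that by auto
  have row_sum: "(\<Sum>k\<in>{k \<in> {..<N} \<times> {..<M}. fst k = i}. f k) = (\<Sum>j<M. f (i, j))" if "i \<in> {..<N}"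
    for i and f :: "nat \<times> nat \<Rightarrow> 'a :: comm_monoid_add"
    unfolding row[OF that] by (subst sum.reindex) (auto simp: inj_on_def)
  have "(\<integral>\<^sup>+A. (\<Prod>i<N. ennreal (exp (- t * (cmod (\<Sum>j<M. A (i, j) * d j))\<^sup>2))) \<partial>gaussian_matrix N M) =
    (\<integral>\<^sup>+A. (\<Prod>i<N. ennreal (exp (- t * (cmod ((\<Sum>k\<in>{k \<in> {..<N} \<times> {..<M}. fst k = i}. d (snd k) * A k) + 0))\<^sup>2)))
      \<partial>gaussian_matrix N M)"
    by (intro nn_integral_cong prod.cong) (simp_all only: row_sum, simp_all add: mult.commute)
  also have "\<dots> = (\<Prod>i<N. ennreal (exp (- t * (cmod 0)\<^sup>2 / (1 + t * 1 * (\<Sum>k\<in>{k \<in> {..<N} \<times> {..<M}. fst k = i}. (cmod (d (snd k)))\<^sup>2)))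
      / (1 + t * 1 * (\<Sum>k\<in>{k \<in> {..<N} \<times> {..<M}. fst k = i}. (cmod (d (snd k)))\<^sup>2))))"
    unfolding gaussian_matrix_def
  proof (rule nn_integral_PiM_complex_normal_exp_squares)
    show "1 + t * 1 * (\<Sum>k\<in>{k \<in> {..<N} \<times> {..<M}. fst k = i}. (cmod (d (snd k)))\<^sup>2) > 0" if "i \<in> {..<N}" for i
      using pos that by (simp only: row_sum) simp
  qed auto
  also have "\<dots> = (\<Prod>i<N. ennreal (1 / (1 + t * (\<Sum>j<M. (cmod (d j))\<^sup>2))))"
    by (intro prod.cong) (simp_all only: row_sum, simp_all)
  also have "\<dots> = ennreal ((1 / (1 + t * (\<Sum>j<M. (cmod (d j))\<^sup>2))) ^ N)"
    using pos by (simp add: ennreal_power)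
  finally show ?thesis .
qed

section \<open>Union and Chernoff bounds for the error probability\<close>

text \<open>
  Neither the set below nor the function in the next lemma has to be measurable: the junk value 0 of
  \<^const>\<open>measure\<close> and of the Bochner integral only helps an upper bound.
\<close>

lemma ennreal_measure_le_nn_integral:
  assumes "\<And>x. x \<in> S \<Longrightarrow> 1 \<le> g x"
  shows "ennreal (measure M S) \<le> (\<integral>\<^sup>+x. g x \<partial>M)"
proof (cases "S \<in> sets M")
  case True
  have "ennreal (measure M S) \<le> emeasure M S"
    by (cases "emeasure M S = \<top>") (auto simp: emeasure_eq_ennreal_measure)
  also have "\<dots> = (\<integral>\<^sup>+x. indicator S x \<partial>M)" using True by simp
  also have "\<dots> \<le> (\<integral>\<^sup>+x. g x \<partial>M)"
    using assms by (intro nn_integral_mono) (auto simp: indicator_def)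
  finally show ?thesis .
next
  case False
  then show ?thesis by (simp add: measure_notin_sets)
qed

lemma ennreal_integral_le_nn_integral:
  fixes f :: "'a \<Rightarrow> real"
  assumes "\<And>x. f x \<ge> 0"
  shows "ennreal (integral\<^sup>L M f) \<le> (\<integral>\<^sup>+x. ennreal (f x) \<partial>M)"
  by (cases "integrable M f") (simp_all add: nn_integral_eq_integral assms not_integrable_integral_eq)

text \<open>By \<open>err\<close>, the indicator of an error is at most a sum of exponentials: one
  with parameter \<open>- t\<^sub>0\<close> for a large residual at \<open>z\<^sub>0\<close>, and
  one with parameter \<open>t\<^sub>1\<close> for a small residual at each element of
  \<open>B\<close>. Their expectations are known exactly. The condition
  \<open>t\<^sub>0 * s z\<^sub>0 < 1\<close> makes the first one finite.\<close>

lemma p_err_le_chernoff: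
  fixes N M :: nat and \<nu> :: real and x z\<^sub>0 :: "nat \<Rightarrow> complex" and B :: "(nat \<Rightarrow> complex) set"
  defines "s \<equiv> \<lambda>z. (\<Sum>j<M. (cmod (x j - z j))\<^sup>2) + \<nu>\<^sup>2"
  assumes "\<nu> > 0" and "finite B" and "t\<^sub>0 \<ge> 0" and t0: "t\<^sub>0 * s z\<^sub>0 < 1" and "t\<^sub>1 \<ge> 0"
    and err: "\<And>A n. \<lbrakk>A \<in> space (gaussian_matrix N M); n \<in> space (gaussian_noise N \<nu>);
      \<not> success2 \<alpha> M x (d A (observation N M x A n))\<rbrakk> \<Longrightarrow>
      residual N M A (observation N M x A n) z\<^sub>0 \<ge> real N * \<theta> \<or>
      (\<exists>z\<in>B. residual N M A (observation N M x A n) z \<le> real N * \<theta>)"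
  shows "p_err \<alpha> \<nu> N M d x \<le>
    (exp (- t\<^sub>0 * \<theta>) / (1 - t\<^sub>0 * s z\<^sub>0)) ^ N + (\<Sum>z\<in>B. (exp (t\<^sub>1 * \<theta>) / (1 + t\<^sub>1 * s z)) ^ N)"
proof -
  define g where "g t z A n =
    ennreal (exp (t * (real N * \<theta> - residual N M A (observation N M x A n) z)))" for t z A n
  have g_meas [measurable]: "g t z A \<in> borel_measurable (gaussian_noise N \<nu>)" for t z A
    unfolding g_def residual_observation gaussian_noise_def by measurable
  have spos: "s z > 0" for z
    using \<open>\<nu> > 0\<close> unfolding s_def by (intro add_nonneg_pos sum_nonneg) auto
  have inner: "(\<integral>\<^sup>+n. g t z A n \<partial>gaussian_noise N \<nu>) = ennreal ((exp (t * \<theta>) / (1 + t * \<nu>\<^sup>2)) ^ N) *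
      (\<Prod>i<N. ennreal (exp (- (t / (1 + t * \<nu>\<^sup>2)) * (cmod (\<Sum>j<M. A (i, j) * (x j - z j)))\<^sup>2)))"
    if "1 + t * \<nu>\<^sup>2 > 0" for t z A
    unfolding g_def residual_observation using \<open>\<nu> > 0\<close> that by (rule nn_integral_noise_exp_squares)
  have prod_meas [measurable]:
    "(\<lambda>A. \<Prod>i<N. ennreal (exp (- t * (cmod (\<Sum>j<M. A (i, j) * (x j - z j)))\<^sup>2)))
      \<in> borel_measurable (gaussian_matrix N M)" for t z
    unfolding gaussian_matrix_def by measurable
  have inner_meas: "(\<lambda>A. \<integral>\<^sup>+n. g t z A n \<partial>gaussian_noise N \<nu>) \<in> borel_measurable (gaussian_matrix N M)"
    if "1 + t * \<nu>\<^sup>2 > 0" for t z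
    unfolding inner[OF that] by measurable
  \<comment> \<open>Integrating the noise leaves the parameter \<open>t / q\<close> for the matrix.
    The two denominators multiply to \<open>1 + t * s z\<close>, in accordance with
    \<open>s z\<close> being the variance of a residual entry.\<close>
  have total: "(\<integral>\<^sup>+A. \<integral>\<^sup>+n. g t z A n \<partial>gaussian_noise N \<nu> \<partial>gaussian_matrix N M) =
      ennreal ((exp (t * \<theta>) / (1 + t * s z)) ^ N)" if pos: "1 + t * \<nu>\<^sup>2 > 0" "1 + t * s z > 0" for t z
  proof -
    define S where "S = (\<Sum>j<M. (cmod (x j - z j))\<^sup>2)"
    define q where "q = 1 + t * \<nu>\<^sup>2"
    have eq: "q * (1 + t / q * S) = 1 + t * s z"
      using pos(1) by (simp add: q_def s_def S_def field_simps)
    have pos': "1 + t / q * S > 0"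
      using eq pos unfolding q_def[symmetric] by (metis zero_less_mult_pos)
    have "(\<integral>\<^sup>+A. \<integral>\<^sup>+n. g t z A n \<partial>gaussian_noise N \<nu> \<partial>gaussian_matrix N M) =
       ennreal ((exp (t * \<theta>) / q) ^ N) * (\<integral>\<^sup>+A. (\<Prod>i<N. ennreal (exp (- (t / q) *
         (cmod (\<Sum>j<M. A (i, j) * (x j - z j)))\<^sup>2))) \<partial>gaussian_matrix N M)"
      unfolding inner[OF pos(1)] q_def by (rule nn_integral_cmult) measurable
    also have "\<dots> = ennreal ((exp (t * \<theta>) / q) ^ N) * ennreal ((1 / (1 + t / q * S)) ^ N)"
      unfolding S_def using pos' by (subst nn_integral_matrix_exp_squares) (auto simp: S_def)
    also have "\<dots> = ennreal ((exp (t * \<theta>) / (q * (1 + t / q * S))) ^ N)"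
      using pos pos' by (simp add: q_def ennreal_mult'[symmetric] power_mult_distrib power_divide)
    finally show ?thesis unfolding eq .
  qed
  have t0': "1 + (- t\<^sub>0) * s z\<^sub>0 > 0" using t0 by simp
  \<comment> \<open>The inner integral over the noise alone must converge too; this follows since
    \<open>\<nu>\<^sup>2\<close> is only a part of \<open>s z\<^sub>0\<close>.\<close>
  have "t\<^sub>0 * \<nu>\<^sup>2 \<le> t\<^sub>0 * s z\<^sub>0"
    using \<open>t\<^sub>0 \<ge> 0\<close> unfolding s_def by (intro mult_left_mono) (auto intro!: sum_nonneg)
  then have t0'': "1 + (- t\<^sub>0) * \<nu>\<^sup>2 > 0" using t0 by simp
  have t1': "1 + t\<^sub>1 * s z > 0" and t1'': "1 + t\<^sub>1 * \<nu>\<^sup>2 > 0" for z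
    using \<open>t\<^sub>1 \<ge> 0\<close> spos[of z] by (auto intro!: add_pos_nonneg)
  have one_le: "1 \<le> g (- t\<^sub>0) z\<^sub>0 A n + (\<Sum>z\<in>B. g t\<^sub>1 z A n)"
    if "A \<in> space (gaussian_matrix N M)" "n \<in> space (gaussian_noise N \<nu>)"
      "\<not> success2 \<alpha> M x (d A (observation N M x A n))" for A n
    using err[OF that]
  proof
    assume "residual N M A (observation N M x A n) z\<^sub>0 \<ge> real N * \<theta>"
    then have "1 \<le> g (- t\<^sub>0) z\<^sub>0 A n"
      using \<open>t\<^sub>0 \<ge> 0\<close> unfolding g_def by (simp add: mult_nonneg_nonpos)
    then show ?thesis by (rule order_trans) simp
  next
    assume "\<exists>z\<in>B. residual N M A (observation N M x A n) z \<le> real N * \<theta>"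
    then obtain z where z: "z \<in> B" "residual N M A (observation N M x A n) z \<le> real N * \<theta>" by blast
    then have "1 \<le> g t\<^sub>1 z A n"
      using \<open>t\<^sub>1 \<ge> 0\<close> unfolding g_def by simp
    also have "\<dots> \<le> (\<Sum>z\<in>B. g t\<^sub>1 z A n)"
      using z(1) \<open>finite B\<close> by (intro member_le_sum) auto
    finally show ?thesis by (rule order_trans) simp
  qed
  have "ennreal (p_err \<alpha> \<nu> N M d x) \<le> (\<integral>\<^sup>+A. ennreal (p_err_given \<alpha> \<nu> N M d x A) \<partial>gaussian_matrix N M)"
    unfolding p_err_def by (rule ennreal_integral_le_nn_integral) (simp add: p_err_given_def)
  also have "\<dots> \<le> (\<integral>\<^sup>+A. \<integral>\<^sup>+n. g (- t\<^sub>0) z\<^sub>0 A n + (\<Sum>z\<in>B. g t\<^sub>1 z A n) \<partial>gaussian_noise N \<nu> \<partial>gaussian_matrix N M)"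
    unfolding p_err_given_def
    by (intro nn_integral_mono ennreal_measure_le_nn_integral) (use one_le in auto)
  also have "\<dots> = (\<integral>\<^sup>+A. (\<integral>\<^sup>+n. g (- t\<^sub>0) z\<^sub>0 A n \<partial>gaussian_noise N \<nu>) +
      (\<Sum>z\<in>B. \<integral>\<^sup>+n. g t\<^sub>1 z A n \<partial>gaussian_noise N \<nu>) \<partial>gaussian_matrix N M)"
    by (intro nn_integral_cong) (simp add: nn_integral_add nn_integral_sum)
  also have "\<dots> = (\<integral>\<^sup>+A. \<integral>\<^sup>+n. g (- t\<^sub>0) z\<^sub>0 A n \<partial>gaussian_noise N \<nu> \<partial>gaussian_matrix N M) +
      (\<Sum>z\<in>B. \<integral>\<^sup>+A. \<integral>\<^sup>+n. g t\<^sub>1 z A n \<partial>gaussian_noise N \<nu> \<partial>gaussian_matrix N M)"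
    using inner_meas[OF t0''] inner_meas[OF t1'']
    by (subst nn_integral_add) (auto intro!: borel_measurable_sum nn_integral_sum)
  also have "\<dots> = ennreal ((exp (- t\<^sub>0 * \<theta>) / (1 - t\<^sub>0 * s z\<^sub>0)) ^ N + (\<Sum>z\<in>B. (exp (t\<^sub>1 * \<theta>) / (1 + t\<^sub>1 * s z)) ^ N))"
    using t0' t1' unfolding total[OF t0'' t0'] total[OF t1'' t1']
    by (subst ennreal_plus) (auto intro!: sum_nonneg simp: sum_ennreal less_imp_le)
  finally show ?thesis
    using t0' t1' by (subst (asm) ennreal_le_iff) (auto intro!: add_nonneg_nonneg sum_nonneg simp: less_imp_le)
qed

section \<open>The threshold decoder\<close>

text \<open>
  If no candidate passes the test, the value of \<open>LEAST\<close> is unspecified, but the output still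
  belongs to \<open>Z\<close>.
\<close>

definition threshold_decoder :: "(nat \<Rightarrow> complex) set \<Rightarrow> nat \<Rightarrow> nat \<Rightarrow> real \<Rightarrow> decoder" where
  "threshold_decoder Z N M \<theta> A y =
    from_nat_into Z (LEAST k. residual N M A y (from_nat_into Z k) \<le> real N * \<theta>)"

text \<open>Measurability holds because the decoder factors through a natural number: the least
  passing index is measurable in the matrix and the observation, and every map from the discrete
  space of indices into the target space is measurable.\<close>

lemma is_decoder_threshold_decoder:
  assumes "Z \<noteq> {}" and "Z \<subseteq> extensional {..<M}" and "\<And>z. z \<in> Z \<Longrightarrow> card (supp M z) = L"
  shows "is_decoder N M L (threshold_decoder Z N M \<theta>)"
proof -
  let ?\<Omega> = "PiM ({..<N} \<times> {..<M}) (\<lambda>_. borel) \<Otimes>\<^sub>M PiM {..<N} (\<lambda>_. borel)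
    :: ((nat \<times> nat \<Rightarrow> complex) \<times> (nat \<Rightarrow> complex)) measure"
  have in_Z: "from_nat_into Z k \<in> Z" for k by (rule from_nat_into) fact
  have [measurable]: "(\<lambda>p. residual N M (fst p) (snd p) z) \<in> borel_measurable ?\<Omega>" for z
    unfolding residual_def by measurable
  have "(\<lambda>p. LEAST k. residual N M (fst p) (snd p) (from_nat_into Z k) \<le> real N * \<theta>)
      \<in> ?\<Omega> \<rightarrow>\<^sub>M count_space UNIV"
    by measurable
  moreover have "from_nat_into Z \<in> count_space UNIV \<rightarrow>\<^sub>M PiM {..<M} (\<lambda>_. borel)"
    using in_Z assms(2) by (auto simp: space_PiM PiE_def)
  ultimately have "(\<lambda>p. from_nat_into Z (LEAST k. residual N M (fst p) (snd p) (from_nat_into Z k) \<le> real N * \<theta>))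
      \<in> ?\<Omega> \<rightarrow>\<^sub>M PiM {..<M} (\<lambda>_. borel)"
    by (rule measurable_compose)
  then show ?thesis
    using in_Z assms(3) unfolding is_decoder_def threshold_decoder_def by (auto simp: case_prod_beta)
qed

text \<open>If some candidate passes the test, \<open>LEAST\<close> selects one that passes.
  Otherwise \<open>z\<^sub>0\<close> fails in particular, since countability places it in the
  enumeration. This supplies the dichotomy \<open>err\<close> of the Chernoff bound.\<close>

lemma threshold_decoder_cases:
  assumes "countable Z" and "z\<^sub>0 \<in> Z"
  shows "residual N M A y z\<^sub>0 \<ge> real N * \<theta> \<or>
    threshold_decoder Z N M \<theta> A y \<in> Z \<and>
    residual N M A y (threshold_decoder Z N M \<theta> A y) \<le> real N * \<theta>"
proof (cases "\<exists>k. residual N M A y (from_nat_into Z k) \<le> real N * \<theta>")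
  case True
  then have "residual N M A y (threshold_decoder Z N M \<theta> A y) \<le> real N * \<theta>"
    unfolding threshold_decoder_def by (rule LeastI_ex)
  moreover have "threshold_decoder Z N M \<theta> A y \<in> Z"
    unfolding threshold_decoder_def using assms(2) by (intro from_nat_into) auto
  ultimately show ?thesis by simp
next
  case False
  moreover obtain k where "z\<^sub>0 = from_nat_into Z k"
    using from_nat_into_surj[OF assms] by metis
  ultimately show ?thesis by (metis linear)
qed

section \<open>A finite net of sparse vectors\<close>

text \<open>The offset \<open>1 / 2\<close> keeps the grid away from 0, so that rounding preserves the support.\<close>

definition offset_grid :: "nat \<Rightarrow> complex set" where
  "offset_grid M = (\<lambda>(a, b). Complex ((of_int a + 1 / 2) / real M) (of_int b / real M)) `
    ({- int (M\<^sup>2)..int (M\<^sup>2)} \<times> {- int (M\<^sup>2)..int (M\<^sup>2)})"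

lemma finite_offset_grid: "finite (offset_grid M)"
  by (simp add: offset_grid_def)

lemma offset_grid_nonempty: "offset_grid M \<noteq> {}"
  by (simp add: offset_grid_def)

lemma zero_notin_offset_grid:
  assumes "M > 0" shows "0 \<notin> offset_grid M"
proof
  assume "0 \<in> offset_grid M"
  then obtain p :: "int \<times> int" where
    "0 = (\<lambda>(a, b). Complex ((of_int a + 1 / 2) / real M) (of_int b / real M)) p"
    unfolding offset_grid_def by (rule imageE)
  then have "(of_int (fst p) + 1 / 2) / real M = 0"
    by (auto simp only: case_prod_beta complex_eq_iff complex.sel zero_complex.sel)
  then have "real_of_int (2 * fst p + 1) = 0" using assms by simp
  then have "2 * fst p + 1 = 0" by linarith
  then show False by presburger
qed

text \<open>A crude polynomial bound suffices: each of the two coordinates takes at most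
  \<open>M ^ 4\<close> values.\<close>

lemma card_offset_grid_le:
  assumes "M \<ge> 2" shows "card (offset_grid M) \<le> M ^ 8"
proof -
  have "card (offset_grid M) \<le> (2 * M\<^sup>2 + 1) * (2 * M\<^sup>2 + 1)"
    unfolding offset_grid_def
    by (rule order_trans[OF card_image_le]) (simp_all add: nat_add_distrib nat_mult_distrib nat_power_eq)
  also have "\<dots> \<le> M ^ 4 * M ^ 4"
  proof -
    have "2 * M\<^sup>2 + 1 \<le> 4 * M\<^sup>2" using assms by (simp add: power2_eq_square)
    also have "\<dots> \<le> M\<^sup>2 * M\<^sup>2" by (rule mult_le_mono1) (use power_mono[OF assms, of 2] in simp)
    also have "\<dots> = M ^ 4" by (simp add: power_add[symmetric])
    finally show ?thesis by (intro mult_mono) auto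
  qed
  finally show ?thesis by (simp add: power_add[symmetric])
qed

text \<open>Both scaled coordinates are rounded by the floor function, with an error of at most
  \<open>1 / M\<close> each.\<close>

lemma offset_grid_approx:
  assumes "M \<ge> 1" and "cmod w \<le> real M - 1"
  shows "\<exists>g\<in>offset_grid M. (cmod (w - g))\<^sup>2 \<le> 2 / (real M)\<^sup>2"
proof -
  define a where "a = \<lfloor>real M * Re w\<rfloor>"
  define b where "b = \<lfloor>real M * Im w\<rfloor>"
  define g where "g = Complex ((of_int a + 1 / 2) / real M) (of_int b / real M)"
  have M: "real M \<ge> 1" using assms by simp
  \<comment> \<open>The margin between \<open>M - 1\<close> and \<open>M\<close> absorbs the
    rounding: \<open>M * (M - 1) + 1\<close> is still at most \<open>M\<^sup>2\<close>.\<close>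
  have range: "\<lfloor>real M * r\<rfloor> \<in> {- int (M\<^sup>2)..int (M\<^sup>2)}" if "\<bar>r\<bar> \<le> cmod w" for r
  proof -
    have "\<bar>real M * r\<bar> \<le> real M * (real M - 1)"
      using that assms by (simp add: abs_mult mult_left_mono)
    then have "\<bar>real M * r\<bar> + 1 \<le> (real M)\<^sup>2"
      using M by (simp add: algebra_simps power2_eq_square)
    moreover have "real_of_int (int (M\<^sup>2)) = (real M)\<^sup>2" by simp
    ultimately have "real_of_int \<lfloor>real M * r\<rfloor> \<le> real_of_int (int (M\<^sup>2))
      \<and> real_of_int (- int (M\<^sup>2)) \<le> real_of_int \<lfloor>real M * r\<rfloor>"
      unfolding of_int_minus by linarith
    then show ?thesis by (simp only: of_int_le_iff atLeastAtMost_iff)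
  qed
  have "g \<in> offset_grid M"
    unfolding offset_grid_def g_def a_def b_def
    using range[OF abs_Re_le_cmod] range[OF abs_Im_le_cmod] by (intro image_eqI[of _ _ "(a, b)"]) (auto simp: a_def b_def)
  moreover have "(cmod (w - g))\<^sup>2 \<le> 2 / (real M)\<^sup>2"
  proof -
    have "Re (w - g) = (real M * Re w - (of_int a + 1 / 2)) / real M"
      using M by (simp add: g_def field_simps)
    then have "\<bar>Re (w - g)\<bar> = \<bar>real M * Re w - (of_int a + 1 / 2)\<bar> / real M"
      by (simp only: abs_divide abs_of_nat)
    also have "\<dots> \<le> 1 / real M"
      using M unfolding a_def by (intro divide_right_mono) linarith+
    finally have re: "(Re (w - g))\<^sup>2 \<le> (1 / real M)\<^sup>2"
      by (metis abs_ge_zero power2_abs power_mono)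
    have "Im (w - g) = (real M * Im w - of_int b) / real M"
      using M by (simp add: g_def field_simps)
    then have "\<bar>Im (w - g)\<bar> = \<bar>real M * Im w - of_int b\<bar> / real M"
      by (simp only: abs_divide abs_of_nat)
    also have "\<dots> \<le> 1 / real M"
      using M unfolding b_def by (intro divide_right_mono) linarith+
    finally have im: "(Im (w - g))\<^sup>2 \<le> (1 / real M)\<^sup>2"
      by (metis abs_ge_zero power2_abs power_mono)
    show ?thesis
      using add_mono[OF re im] by (simp add: cmod_power2 power_divide)
  qed
  ultimately show ?thesis by blast
qed

text \<open>Candidates are \<open>undefined\<close> outside \<open>{..<M}\<close>, which makes them
  points of the product space into which a decoder maps.\<close>

definition sparse_net :: "nat \<Rightarrow> nat \<Rightarrow> (nat \<Rightarrow> complex) set" where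
  "sparse_net M L = (\<Union>S\<in>{S. S \<subseteq> {..<M} \<and> card S = L}.
    (\<lambda>f. \<lambda>i\<in>{..<M}. if i \<in> S then f i else 0) ` (S \<rightarrow>\<^sub>E offset_grid M))"

lemma finite_sparse_net: "finite (sparse_net M L)"
proof -
  have "finite {S. S \<subseteq> {..<M} \<and> card S = L}"
    by (rule rev_finite_subset[of "Pow {..<M}"]) auto
  moreover have "finite (S \<rightarrow>\<^sub>E offset_grid M)" if "S \<subseteq> {..<M}" for S
    using that by (intro finite_PiE finite_offset_grid) (rule finite_subset, auto)
  ultimately show ?thesis unfolding sparse_net_def by auto
qed

lemma sparse_net_extensional: "sparse_net M L \<subseteq> extensional {..<M}"
  by (auto simp: sparse_net_def)

lemma card_supp_sparse_net:
  assumes "M > 0" and "z \<in> sparse_net M L" shows "card (supp M z) = L"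
proof -
  obtain S f where S: "S \<subseteq> {..<M}" "card S = L" and f: "f \<in> S \<rightarrow>\<^sub>E offset_grid M"
    and z: "z = (\<lambda>i\<in>{..<M}. if i \<in> S then f i else 0)"
    using assms(2) by (auto simp: sparse_net_def)
  have "supp M z = S"
    using S(1) f zero_notin_offset_grid[OF assms(1)] unfolding supp_def z
    by (auto dest: PiE_mem split: if_splits)
  then show ?thesis using S(2) by simp
qed

lemma sparse_net_nonempty:
  assumes "L \<le> M" shows "sparse_net M L \<noteq> {}"
proof -
  have "{..<L} \<subseteq> {..<M} \<and> card {..<L} = L" using assms by auto
  moreover have "{..<L} \<rightarrow>\<^sub>E offset_grid M \<noteq> {}"
    by (simp add: PiE_eq_empty_iff offset_grid_nonempty)
  ultimately show ?thesis unfolding sparse_net_def by blast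
qed

text \<open>The choice of the support costs a factor of at most \<open>M ^ L\<close>, the values on
  it at most \<open>(M ^ 8) ^ L\<close>.\<close>

lemma card_sparse_net_le:
  assumes "M \<ge> 2" and "L \<le> M" shows "card (sparse_net M L) \<le> M ^ (9 * L)"
proof -
  let ?F = "{S. S \<subseteq> {..<M} \<and> card S = L}"
  have fin: "finite ?F" by (rule rev_finite_subset[of "Pow {..<M}"]) auto
  have fin': "finite S" if "S \<in> ?F" for S using that finite_subset[of S "{..<M}"] by auto
  have "card (sparse_net M L) \<le> (\<Sum>S\<in>?F. card ((\<lambda>f. \<lambda>i\<in>{..<M}. if i \<in> S then f i else 0) ` (S \<rightarrow>\<^sub>E offset_grid M)))"
    unfolding sparse_net_def by (rule card_UN_le) (rule fin)
  also have "\<dots> \<le> (\<Sum>S\<in>?F. card (offset_grid M) ^ L)"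
  proof (rule sum_mono)
    fix S assume S: "S \<in> ?F"
    have "card ((\<lambda>f. \<lambda>i\<in>{..<M}. if i \<in> S then f i else 0) ` (S \<rightarrow>\<^sub>E offset_grid M)) \<le> card (S \<rightarrow>\<^sub>E offset_grid M)"
      using fin'[OF S] by (intro card_image_le finite_PiE) (auto simp: finite_offset_grid)
    also have "\<dots> = card (offset_grid M) ^ L"
      using fin'[OF S] S by (simp add: card_PiE)
    finally show "card ((\<lambda>f. \<lambda>i\<in>{..<M}. if i \<in> S then f i else 0) ` (S \<rightarrow>\<^sub>E offset_grid M)) \<le> card (offset_grid M) ^ L" .
  qed
  also have "\<dots> = (M choose L) * card (offset_grid M) ^ L"
    by (simp add: n_subsets)
  also have "\<dots> \<le> M ^ L * (M ^ 8) ^ L"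
    using assms by (intro mult_mono binomial_le_pow power_mono card_offset_grid_le) auto
  also have "\<dots> = M ^ (9 * L)"
    by (simp add: power_mult[symmetric] power_add[symmetric])
  finally show ?thesis .
qed

text \<open>Each nonzero entry is rounded to the grid and the support is kept. At most
  \<open>M\<close> squared errors of size \<open>2 / M\<^sup>2\<close> add up. The bound on the
  power puts every entry within the range of the grid.\<close>

lemma sparse_net_approx:
  assumes "M \<ge> 1" and "card (supp M x) = L" and "power M x \<le> (real M - 1)\<^sup>2"
  shows "\<exists>z\<in>sparse_net M L. (\<Sum>j<M. (cmod (x j - z j))\<^sup>2) \<le> 2 / real M"
proof -
  have le: "cmod (x j) \<le> real M - 1" if "j < M" for j
  proof -
    have "(cmod (x j))\<^sup>2 \<le> power M x"
      unfolding power_def using that by (intro member_le_sum) auto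
    then have "(cmod (x j))\<^sup>2 \<le> (real M - 1)\<^sup>2" using assms(3) by linarith
    then show ?thesis by (rule power2_le_imp_le) (use assms(1) in simp)
  qed
  have "\<exists>g. g \<in> offset_grid M \<and> (cmod (x j - g))\<^sup>2 \<le> 2 / (real M)\<^sup>2" if "j \<in> supp M x" for j
    using offset_grid_approx[OF assms(1) le[of j]] that by (auto simp: supp_def)
  then obtain f where f: "\<And>j. j \<in> supp M x \<Longrightarrow> f j \<in> offset_grid M"
    "\<And>j. j \<in> supp M x \<Longrightarrow> (cmod (x j - f j))\<^sup>2 \<le> 2 / (real M)\<^sup>2" by metis
  define z where "z = (\<lambda>i\<in>{..<M}. if i \<in> supp M x then restrict f (supp M x) i else 0)"
  have "restrict f (supp M x) \<in> supp M x \<rightarrow>\<^sub>E offset_grid M" using f(1) by auto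
  moreover have "supp M x \<in> {S. S \<subseteq> {..<M} \<and> card S = L}" using assms(2) by (auto simp: supp_def)
  ultimately have "z \<in> sparse_net M L" unfolding sparse_net_def z_def by blast
  moreover have "(\<Sum>j<M. (cmod (x j - z j))\<^sup>2) \<le> (\<Sum>j<M. 2 / (real M)\<^sup>2)"
  proof (rule sum_mono)
    fix j assume j: "j \<in> {..<M}"
    show "(cmod (x j - z j))\<^sup>2 \<le> 2 / (real M)\<^sup>2"
      using f(2)[of j] j by (cases "j \<in> supp M x") (auto simp: z_def supp_def)
  qed
  then have "(\<Sum>j<M. (cmod (x j - z j))\<^sup>2) \<le> 2 / real M"
    using assms(1) by (simp add: power2_eq_square)
  ultimately show ?thesis by blast
qed

section \<open>Separation of wrong candidates and the exponential error bound\<close>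

text \<open>A failure misses at least \<open>\<alpha> * L\<close> indices of the support. At each of
  them \<open>z\<close> vanishes, so the squared difference is at least the square of the minimal
  modulus.\<close>

lemma missed_energy_ge:
  assumes "card (supp M x) = L" and "0 < L" and "\<not> success2 \<alpha> M x z"
  shows "\<alpha> * (real L * (min_abs M x)\<^sup>2) \<le> (\<Sum>j<M. (cmod (x j - z j))\<^sup>2)"
proof -
  let ?D = "supp M x - supp M z"
  have fin: "finite (supp M x)" by (simp add: supp_def)
  have "real (card (supp M z \<inter> supp M x)) \<le> (1 - \<alpha>) * real L"
    using assms by (simp add: success2_def field_simps)
  moreover have "card ?D = L - card (supp M z \<inter> supp M x)"
    using fin assms(1) by (simp add: card_Diff_subset_Int Int_commute)
  moreover have "card (supp M z \<inter> supp M x) \<le> L"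
    using fin assms(1) by (auto intro: card_mono)
  ultimately have "\<alpha> * real L \<le> real (card ?D)" by (simp add: of_nat_diff algebra_simps)
  then have "\<alpha> * (real L * (min_abs M x)\<^sup>2) \<le> real (card ?D) * (min_abs M x)\<^sup>2"
    by (simp add: mult_right_mono mult.assoc[symmetric])
  also have "\<dots> = (\<Sum>j\<in>?D. (min_abs M x)\<^sup>2)" by simp
  also have "\<dots> \<le> (\<Sum>j\<in>?D. (cmod (x j - z j))\<^sup>2)"
  proof (rule sum_mono)
    fix j assume j: "j \<in> ?D"
    have "supp M x \<noteq> {}" using assms by auto
    then have "min_abs M x \<in> (\<lambda>i. cmod (x i)) ` supp M x"
      unfolding min_abs_def using fin by (intro Min_in) auto
    then have "0 \<le> min_abs M x" by auto
    moreover have "min_abs M x \<le> cmod (x j)"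
      unfolding min_abs_def using j fin by (intro Min_le) auto
    moreover have "z j = 0" using j by (auto simp: supp_def)
    ultimately show "(min_abs M x)\<^sup>2 \<le> (cmod (x j - z j))\<^sup>2" by (simp add: power_mono)
  qed
  also have "\<dots> \<le> (\<Sum>j<M. (cmod (x j - z j))\<^sup>2)"
    by (intro sum_mono2) (auto simp: supp_def)
  finally show ?thesis .
qed

text \<open>The choice \<open>t = 1 / \<theta> - 1 / s\<close> is the optimal exponent for both tails.\<close>

lemma chernoff_factor:
  fixes \<theta> s :: real
  assumes "\<theta> > 0" and "s > 0"
  shows "exp ((1 / \<theta> - 1 / s) * \<theta>) / (1 + (1 / \<theta> - 1 / s) * s) = exp (- (\<theta> / s - 1 - ln (\<theta> / s)))"
proof -
  have "(1 / \<theta> - 1 / s) * \<theta> = 1 - \<theta> / s" and "1 + (1 / \<theta> - 1 / s) * s = s / \<theta>"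
    using assms by (simp_all add: field_simps)
  moreover have "exp (- (\<theta> / s - 1 - ln (\<theta> / s))) = exp (1 - \<theta> / s) * exp (ln (\<theta> / s))"
    by (simp add: exp_add[symmetric])
  ultimately show ?thesis using assms by simp
qed

lemma chernoff_exponent_pos:
  fixes u :: real
  assumes "u > 0" and "u \<noteq> 1"
  shows "u - 1 - ln u > 0"
  using ln_le_minus_one[OF assms(1)] ln_eq_minus_one[OF assms(1)] assms(2) by fastforce

text \<open>The threshold separates \<open>s\<^sub>0\<close>, an upper bound for the variance at the
  nearest candidate, from \<open>s\<^sub>1\<close>, a lower bound at every wrong one. The gaps
  depend only on \<alpha>, \<kappa> and \<nu>, so one exponent \<open>c\<close> serves all
  dimensions and vectors.\<close>

lemma p_err_sparse_net_le:
  fixes \<alpha> \<kappa> \<nu> :: real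
  assumes "0 < \<alpha>" and "0 < \<kappa>" and "0 < \<nu>"
  shows "\<exists>c>0. \<forall>N M L x. 2 \<le> M \<longrightarrow> 8 \<le> \<alpha> * \<kappa> * real M \<longrightarrow> 0 < L \<longrightarrow> L \<le> M \<longrightarrow>
    card (supp M x) = L \<longrightarrow> real L * (min_abs M x)\<^sup>2 = \<kappa> \<longrightarrow> power M x \<le> (real M - 1)\<^sup>2 \<longrightarrow>
    p_err \<alpha> \<nu> N M (threshold_decoder (sparse_net M L) N M (\<nu>\<^sup>2 + \<alpha> * \<kappa> / 2)) x
      \<le> (1 + real M ^ (9 * L)) * exp (- c * real N)"
proof -
  define \<theta> where "\<theta> = \<nu>\<^sup>2 + \<alpha> * \<kappa> / 2"
  \<comment> \<open>The slack \<open>\<alpha> * \<kappa> / 4\<close> accommodates the quantisation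
    error \<open>2 / M\<close>; this is the purpose of the condition
    \<open>8 \<le> \<alpha> * \<kappa> * M\<close>.\<close>
  define s\<^sub>0 where "s\<^sub>0 = \<nu>\<^sup>2 + \<alpha> * \<kappa> / 4"
  define s\<^sub>1 where "s\<^sub>1 = \<nu>\<^sup>2 + \<alpha> * \<kappa>"
  define c where "c = min (\<theta> / s\<^sub>0 - 1 - ln (\<theta> / s\<^sub>0)) (\<theta> / s\<^sub>1 - 1 - ln (\<theta> / s\<^sub>1))"
  define t\<^sub>0 where "t\<^sub>0 = 1 / s\<^sub>0 - 1 / \<theta>"
  define t\<^sub>1 where "t\<^sub>1 = 1 / \<theta> - 1 / s\<^sub>1"
  have "\<alpha> * \<kappa> > 0" "\<nu>\<^sup>2 > 0" using assms by simp_all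
  then have s: "0 < s\<^sub>0" "s\<^sub>0 < \<theta>" "\<theta> < s\<^sub>1" unfolding \<theta>_def s\<^sub>0_def s\<^sub>1_def by linarith+
  have c: "c > 0"
    unfolding c_def min_less_iff_conj using s by (intro conjI chernoff_exponent_pos) auto
  have t: "t\<^sub>0 \<ge> 0" "t\<^sub>1 \<ge> 0" using s by (simp_all add: t\<^sub>0_def t\<^sub>1_def frac_le)
  have t0_lt: "t\<^sub>0 * s\<^sub>0 < 1" using s by (simp add: t\<^sub>0_def field_simps)
  \<comment> \<open>With the sign reversed, \<open>- t\<^sub>0\<close> is the optimal parameter for
    \<open>s\<^sub>0\<close>, so the same formula serves both tails.\<close>
  have f0: "exp (- t\<^sub>0 * \<theta>) / (1 - t\<^sub>0 * s\<^sub>0) \<le> exp (- c)"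
  proof -
    have e: "- t\<^sub>0 = 1 / \<theta> - 1 / s\<^sub>0" "1 - t\<^sub>0 * s\<^sub>0 = 1 + (1 / \<theta> - 1 / s\<^sub>0) * s\<^sub>0"
      by (simp_all add: t\<^sub>0_def algebra_simps)
    have "exp (- t\<^sub>0 * \<theta>) / (1 - t\<^sub>0 * s\<^sub>0) = exp (- (\<theta> / s\<^sub>0 - 1 - ln (\<theta> / s\<^sub>0)))"
      unfolding e by (rule chernoff_factor) (use s in auto)
    then show ?thesis unfolding c_def by simp
  qed
  have f1: "exp (t\<^sub>1 * \<theta>) / (1 + t\<^sub>1 * s\<^sub>1) \<le> exp (- c)"
    unfolding t\<^sub>1_def c_def using s by (subst chernoff_factor) auto
  have "p_err \<alpha> \<nu> N M (threshold_decoder (sparse_net M L) N M \<theta>) x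
      \<le> (1 + real M ^ (9 * L)) * exp (- c * real N)"
    if M: "2 \<le> M" "8 \<le> \<alpha> * \<kappa> * real M" and L: "0 < L" "L \<le> M" "card (supp M x) = L"
      and \<kappa>: "real L * (min_abs M x)\<^sup>2 = \<kappa>" and pow: "power M x \<le> (real M - 1)\<^sup>2" for N M L x
  proof -
    let ?d = "threshold_decoder (sparse_net M L) N M \<theta>"
    define e where "e z = (\<Sum>j<M. (cmod (x j - z j))\<^sup>2)" for z
    define B where "B = {z \<in> sparse_net M L. \<not> success2 \<alpha> M x z}"
    obtain z\<^sub>0 where z0: "z\<^sub>0 \<in> sparse_net M L" "e z\<^sub>0 \<le> 2 / real M"
      using sparse_net_approx[of M x L] M L pow by (auto simp: e_def)
    have "2 / real M \<le> \<alpha> * \<kappa> / 4" using M by (simp add: field_simps)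
    then have e0: "e z\<^sub>0 + \<nu>\<^sup>2 \<le> s\<^sub>0" using z0(2) by (simp add: s\<^sub>0_def)
    then have t0e: "t\<^sub>0 * (e z\<^sub>0 + \<nu>\<^sup>2) \<le> t\<^sub>0 * s\<^sub>0" using t(1) by (rule mult_left_mono)
    have finB: "finite B" by (simp add: B_def finite_sparse_net)
    have e1: "s\<^sub>1 \<le> e z + \<nu>\<^sup>2" if "z \<in> B" for z
      using missed_energy_ge[of M x L \<alpha> z] that L \<kappa> by (simp add: B_def e_def s\<^sub>1_def)
    have "p_err \<alpha> \<nu> N M ?d x \<le> (exp (- t\<^sub>0 * \<theta>) / (1 - t\<^sub>0 * (e z\<^sub>0 + \<nu>\<^sup>2))) ^ N
        + (\<Sum>z\<in>B. (exp (t\<^sub>1 * \<theta>) / (1 + t\<^sub>1 * (e z + \<nu>\<^sup>2))) ^ N)"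
      unfolding e_def
    proof (rule p_err_le_chernoff[OF assms(3) finB t(1) _ t(2)])
      show "t\<^sub>0 * ((\<Sum>j<M. (cmod (x j - z\<^sub>0 j))\<^sup>2) + \<nu>\<^sup>2) < 1"
        using t0e t0_lt by (simp add: e_def)
    next
      fix A n assume "\<not> success2 \<alpha> M x (?d A (observation N M x A n))"
      then show "real N * \<theta> \<le> residual N M A (observation N M x A n) z\<^sub>0 \<or>
          (\<exists>z\<in>B. residual N M A (observation N M x A n) z \<le> real N * \<theta>)"
        using threshold_decoder_cases[OF countable_finite[OF finite_sparse_net] z0(1),
            of N \<theta> M A "observation N M x A n"]
        by (auto simp: B_def)
    qed
    \<comment> \<open>The parameters are fixed and only one-sided bounds on the variances are known.
      Each factor is monotone in its variance, so the extreme values \<open>s\<^sub>0\<close> and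
      \<open>s\<^sub>1\<close> give the worst case.\<close>
    also have "\<dots> \<le> exp (- c) ^ N + (\<Sum>z\<in>B. exp (- c) ^ N)"
    proof (intro add_mono sum_mono power_mono)
      have "exp (- t\<^sub>0 * \<theta>) / (1 - t\<^sub>0 * (e z\<^sub>0 + \<nu>\<^sup>2)) \<le> exp (- t\<^sub>0 * \<theta>) / (1 - t\<^sub>0 * s\<^sub>0)"
        using t0e t0_lt by (intro divide_left_mono mult_pos_pos) auto
      then show "exp (- t\<^sub>0 * \<theta>) / (1 - t\<^sub>0 * (e z\<^sub>0 + \<nu>\<^sup>2)) \<le> exp (- c)" using f0 by linarith
      show "0 \<le> exp (- t\<^sub>0 * \<theta>) / (1 - t\<^sub>0 * (e z\<^sub>0 + \<nu>\<^sup>2))" using t0e t0_lt by simp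
    next
      fix z assume "z \<in> B"
      then have t1e: "t\<^sub>1 * s\<^sub>1 \<le> t\<^sub>1 * (e z + \<nu>\<^sup>2)" using e1 t(2) by (intro mult_left_mono)
      have t1s: "0 \<le> t\<^sub>1 * s\<^sub>1" using t(2) s by simp
      have "exp (t\<^sub>1 * \<theta>) / (1 + t\<^sub>1 * (e z + \<nu>\<^sup>2)) \<le> exp (t\<^sub>1 * \<theta>) / (1 + t\<^sub>1 * s\<^sub>1)"
        using t1e t1s by (intro divide_left_mono mult_pos_pos) auto
      then show "exp (t\<^sub>1 * \<theta>) / (1 + t\<^sub>1 * (e z + \<nu>\<^sup>2)) \<le> exp (- c)" using f1 by linarith
      show "0 \<le> exp (t\<^sub>1 * \<theta>) / (1 + t\<^sub>1 * (e z + \<nu>\<^sup>2))" using t1e t1s by simp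
    qed
    also have "\<dots> = (1 + real (card B)) * exp (- c * real N)"
      by (simp add: exp_of_nat_mult[symmetric] algebra_simps)
    also have "\<dots> \<le> (1 + real M ^ (9 * L)) * exp (- c * real N)"
    proof -
      have "card B \<le> card (sparse_net M L)"
        by (rule card_mono) (auto simp: B_def finite_sparse_net)
      also have "\<dots> \<le> M ^ (9 * L)" using M L by (intro card_sparse_net_le) auto
      finally have "real (card B) \<le> real M ^ (9 * L)" by (metis of_nat_le_iff of_nat_power)
      then show ?thesis by (intro mult_right_mono) auto
    qed
    finally show ?thesis .
  qed
  then show ?thesis using c unfolding \<theta>_def by blast
qed

section \<open>Asymptotics in the dimension\<close>

theorem theoremV3:
  fixes \<alpha> \<kappa> \<nu> :: real
  assumes "0 < \<alpha>" and "\<alpha> < 1" and "0 < \<kappa>" and "0 < \<nu>"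
  shows "\<exists>C>0. \<forall>(M\<^sub>0::nat) (L::nat \<Rightarrow> nat) (N::nat \<Rightarrow> nat).
           (\<forall>M\<ge>M\<^sub>0. 0 < L M \<and> L M \<le> M) \<longrightarrow>
           (\<lambda>M. real (L M)) \<in> o(\<lambda>M. real M) \<longrightarrow>
           eventually_exceeds M\<^sub>0 (\<lambda>M. real (N M))
             (\<lambda>M. C * real (L M) * ln (real M - real (L M))) \<longrightarrow>
           recovery_possible2 \<alpha> \<nu> M\<^sub>0 N L (sparse_sequences M\<^sub>0 L \<kappa>)"
proof -
  obtain c where c: "c > 0" and bound: "\<And>N M L x. \<lbrakk>2 \<le> M; 8 \<le> \<alpha> * \<kappa> * real M; 0 < L; L \<le> M;
      card (supp M x) = L; real L * (min_abs M x)\<^sup>2 = \<kappa>; power M x \<le> (real M - 1)\<^sup>2\<rbrakk> \<Longrightarrow>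
      p_err \<alpha> \<nu> N M (threshold_decoder (sparse_net M L) N M (\<nu>\<^sup>2 + \<alpha> * \<kappa> / 2)) x
        \<le> (1 + real M ^ (9 * L)) * exp (- c * real N)"
    using p_err_sparse_net_le[OF assms(1,3,4)] by blast
  \<comment> \<open>A factor 2 pays for replacing \<open>ln (M - L)\<close> by
    \<open>ln M / 2\<close>. The remaining 10 exceeds by one the exponent 9 in the size of the
    net.\<close>
  define C where "C = 20 / c"
  have "recovery_possible2 \<alpha> \<nu> M\<^sub>0 N L (sparse_sequences M\<^sub>0 L \<kappa>)"
    if L: "\<forall>M\<ge>M\<^sub>0. 0 < L M \<and> L M \<le> M" and small: "(\<lambda>M. real (L M)) \<in> o(\<lambda>M. real M)"
      and exceeds: "eventually_exceeds M\<^sub>0 (\<lambda>M. real (N M)) (\<lambda>M. C * real (L M) * ln (real M - real (L M)))"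
    for M\<^sub>0 :: nat and L N :: "nat \<Rightarrow> nat"
  proof -
    define D where "D M = threshold_decoder (sparse_net M (L M)) (N M) M (\<nu>\<^sup>2 + \<alpha> * \<kappa> / 2)" for M
    have dec: "is_decoder (N M) M (L M) (D M)" if "M \<ge> M\<^sub>0" for M
    proof -
      have "0 < L M" "L M \<le> M" using L that by auto
      then show ?thesis
        unfolding D_def
        by (intro is_decoder_threshold_decoder sparse_net_nonempty sparse_net_extensional card_supp_sparse_net) auto
    qed
    \<comment> \<open>Sparsity gives \<open>M - L \<ge> M / 2\<close>, which is at least
      \<open>sqrt M\<close> from \<open>M = 4\<close> on; hence the two logarithms are
      comparable.\<close>
    have "\<forall>\<^sub>F M in sequentially. real (L M) \<le> 1 / 2 * real M"
      using landau_o.smallD[OF small, of "1 / 2"] by simp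
    then have big: "\<forall>\<^sub>F M in sequentially. M \<ge> M\<^sub>0 \<and> M \<ge> 4 \<and>
        0 < ln (real M - real (L M)) \<and> ln (real M) / 2 \<le> ln (real M - real (L M))"
      using eventually_ge_at_top[of "max M\<^sub>0 4"]
    proof eventually_elim
      case (elim M)
      have "ln (real M) / 2 = ln (sqrt (real M))" using elim by (simp add: ln_sqrt)
      also have "sqrt (real M) \<le> real M / 2"
        using elim by (intro real_le_lsqrt) (auto simp: power2_eq_square)
      then have "ln (sqrt (real M)) \<le> ln (real M - real (L M))"
        using elim by (intro ln_mono) auto
      finally have "ln (real M) / 2 \<le> ln (real M - real (L M))" .
      moreover have "ln (real M) > 0" using elim by simp
      ultimately show ?case using elim by auto
    qed
    \<comment> \<open>The alternative in which both functions vanish is impossible: the right-hand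
      function is positive for large \<open>M\<close>.\<close>
    obtain x\<^sub>0 where x0: "\<forall>M\<ge>M\<^sub>0. M > x\<^sub>0 \<longrightarrow> real (N M) / (C * real (L M) * ln (real M - real (L M))) > 1"
    proof (cases "\<forall>M\<ge>M\<^sub>0. real (N M) = 0 \<and> C * real (L M) * ln (real M - real (L M)) = 0")
      case True
      obtain M where M: "M \<ge> M\<^sub>0" "0 < ln (real M - real (L M))"
        using eventually_happens[OF big] by auto
      then have "C * real (L M) * ln (real M - real (L M)) > 0"
        using L M(1) c by (intro mult_pos_pos) (auto simp: C_def)
      then show ?thesis using True M(1) by force
    next
      case False
      then show ?thesis using exceeds that unfolding eventually_exceeds_def by auto
    qed
    have N: "\<forall>\<^sub>F M in sequentially. M \<ge> M\<^sub>0 \<and> M \<ge> 4 \<and> 10 * real (L M) * ln (real M) \<le> c * real (N M)"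
      using big eventually_gt_at_top[of x\<^sub>0]
    proof eventually_elim
      case (elim M)
      have LM: "real (L M) > 0" using L elim by auto
      have pos: "C * real (L M) * ln (real M - real (L M)) > 0"
        using LM elim c by (intro mult_pos_pos) (auto simp: C_def)
      have "10 * real (L M) * ln (real M) = c * (C * real (L M) * (ln (real M) / 2))"
        using c by (simp add: C_def)
      also have "\<dots> \<le> c * (C * real (L M) * ln (real M - real (L M)))"
        using elim c LM by (intro mult_left_mono) (auto simp: C_def)
      also have "\<dots> \<le> c * real (N M)"
        using x0 elim pos c by (intro mult_left_mono) (auto simp: field_simps)
      finally show ?case using elim by simp
    qed
    have "(\<lambda>M. p_err \<alpha> \<nu> (N M) M (D M) (x M)) \<longlonglongrightarrow> 0" if x: "x \<in> sparse_sequences M\<^sub>0 L \<kappa>" for x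
    proof -
      obtain P where P: "\<forall>M\<ge>M\<^sub>0. power M (x M) = P"
        and x': "\<forall>M\<ge>M\<^sub>0. card (supp M (x M)) = L M" "\<forall>M\<ge>M\<^sub>0. real (L M) * (min_abs M (x M))\<^sup>2 = \<kappa>"
        using x unfolding sparse_sequences_def by auto
      \<comment> \<open>The power \<open>P\<close> varies with the sequence, but it only affects the
        index from which the bound holds: \<open>M \<ge> P + 2\<close> gives
        \<open>P \<le> M - 2 \<le> (M - 1)\<^sup>2\<close>. The other index makes the quantisation
        fine enough.\<close>
      have upper: "\<forall>\<^sub>F M in sequentially. p_err \<alpha> \<nu> (N M) M (D M) (x M) \<le> 2 / real M"
        using N eventually_ge_at_top[of "nat \<lceil>P + 2\<rceil>"] eventually_ge_at_top[of "nat \<lceil>8 / (\<alpha> * \<kappa>)\<rceil>"]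
      proof eventually_elim
        case (elim M)
        have LM: "0 < L M" "L M \<le> M" using L elim by auto
        have M4: "real M \<ge> 4" using elim by simp
        have "P \<le> real M - 2" using elim by linarith
        also have "\<dots> \<le> (real M - 1) * (real M - 1)"
          using M4 mult_mono[of 1 "real M - 1" "real M - 2" "real M - 1"] by simp
        finally have pow: "power M (x M) \<le> (real M - 1)\<^sup>2"
          using P elim by (simp add: power2_eq_square)
        have "8 / (\<alpha> * \<kappa>) \<le> real M" using elim by linarith
        then have "8 \<le> \<alpha> * \<kappa> * real M" using assms by (simp add: field_simps)
        then have "p_err \<alpha> \<nu> (N M) M (D M) (x M) \<le> (1 + real M ^ (9 * L M)) * exp (- c * real (N M))"
          unfolding D_def using elim LM x' pow by (intro bound) auto
        \<comment> \<open>A factor \<open>M ^ L\<close> survives in the denominator. As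
          \<open>L\<close> is at least 1, the bound vanishes even when \<open>L\<close> stays
          bounded.\<close>
        also have "\<dots> \<le> (2 * real M ^ (9 * L M)) * (1 / real M ^ (10 * L M))"
        proof (rule mult_mono)
          show "1 + real M ^ (9 * L M) \<le> 2 * real M ^ (9 * L M)"
            using one_le_power[of "real M" "9 * L M"] M4 by simp
          have "exp (- c * real (N M)) \<le> exp (- (real (10 * L M) * ln (real M)))"
            using elim by simp
          also have "\<dots> = 1 / real M ^ (10 * L M)"
            using M4 by (simp only: exp_minus exp_of_nat_mult) (simp add: inverse_eq_divide)
          finally show "exp (- c * real (N M)) \<le> 1 / real M ^ (10 * L M)" .
        qed (use M4 in auto)
        also have "\<dots> = 2 / real M ^ L M"
        proof -
          have "real M ^ (10 * L M) = real M ^ (9 * L M) * real M ^ L M"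
            by (simp add: power_add[symmetric])
          then show ?thesis using M4 by simp
        qed
        also have "\<dots> \<le> 2 / real M"
          using M4 LM power_increasing[of 1 "L M" "real M"] by (intro divide_left_mono) auto
        finally show ?case .
      qed
      have lower: "\<forall>\<^sub>F M in sequentially. 0 \<le> p_err \<alpha> \<nu> (N M) M (D M) (x M)"
        unfolding p_err_def p_err_given_def by (intro always_eventually allI integral_nonneg_AE) auto
      show ?thesis
        by (rule tendsto_sandwich[OF lower upper tendsto_const lim_const_over_n])
    qed
    then show ?thesis unfolding recovery_possible2_def using dec by blast
  qed
  moreover have "C > 0" using c by (simp add: C_def)
  ultimately show ?thesis by blast
qed

end
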